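(* Let $a<b$, $c<d$, and let $f:\Delta=[a,b]\times[c,d]\to\mathbb{R}$ be a partially differentiable mapping on $\Delta$. If $\left|\frac{\partial^2 f}{\partial t\partial s}\right|$ is a convex function on the co-ordinates on $\Delta$, then $$\left|f\left(\frac{a+b}{2},\frac{c+d}{2}\right)-\frac{1}{d-c}\int_c^d f\left(\frac{a+b}{2},y\right)dy-\frac{1}{b-a}\int_a^b f\left(x,\frac{c+d}{2}\right)dx+\frac{1}{(b-a)(d-c)}\int_a^b\int_c^d f(x,y)\,dy\,dx\right|$$ $$\le\frac{(b-a)(d-c)}{64}\left[\left|\frac{\partial^2 f}{\partial t\partial s}(a,c)\right|+\left|\frac{\partial^2 f}{\partial t\partial s}(b,c)\right|+\left|\frac{\partial^2 f}{\partial t\partial s}(a,d)\right|+\left|\frac{\partial^2 f}{\partial t\partial s}(b,d)\right|\right].$$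
   Context: $\frac{\partial^2 f}{\partial t\partial s}$ denotes the second-order mixed partial derivative of $f$ with respect to its first variable ($t$) and its second variable ($s$), on $\Delta$. A function $g:\Delta=[a,b]\times[c,d]\to\mathbb{R}$ is called convex on the co-ordinates on $\Delta$ if for every $y\in[c,d]$ the partial mapping $g_y:[a,b]\to\mathbb{R}$, $g_y(u)=g(u,y)$, is convex, and for every $x\in[a,b]$ the partial mapping $g_x:[c,d]\to\mathbb{R}$, $g_x(v)=g(x,v)$, is convex. *)

theory Defs
  imports "HOL-Analysis.Analysis"
begin

text \<open>
  Partial derivatives of a function of interest only on a rectangle \<open>I \<times> J\<close>. The difference
  quotients are taken within \<open>I\<close> (resp. \<open>J\<close>), so at the boundary of the rectangle the derivatives
  are one-sided and values of \<open>f\<close> outside the rectangle are irrelevant.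
\<close>

definition partial_fst :: "real set \<Rightarrow> (real \<times> real \<Rightarrow> real) \<Rightarrow> real \<times> real \<Rightarrow> real" where
  "partial_fst I f p = vector_derivative (\<lambda>t. f (t, snd p)) (at (fst p) within I)"

definition partial_snd :: "real set \<Rightarrow> (real \<times> real \<Rightarrow> real) \<Rightarrow> real \<times> real \<Rightarrow> real" where
  "partial_snd J f p = vector_derivative (\<lambda>s. f (fst p, s)) (at (snd p) within J)"

definition differentiable_fst_on :: "real set \<Rightarrow> real set \<Rightarrow> (real \<times> real \<Rightarrow> real) \<Rightarrow> bool" where
  "differentiable_fst_on I J f \<longleftrightarrow> (\<forall>y\<in>J. (\<lambda>t. f (t, y)) differentiable_on I)"

definition differentiable_snd_on :: "real set \<Rightarrow> real set \<Rightarrow> (real \<times> real \<Rightarrow> real) \<Rightarrow> bool" where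
  "differentiable_snd_on I J f \<longleftrightarrow> (\<forall>x\<in>I. (\<lambda>s. f (x, s)) differentiable_on J)"

definition partially_differentiable_on :: "real set \<Rightarrow> real set \<Rightarrow> (real \<times> real \<Rightarrow> real) \<Rightarrow> bool" where
  "partially_differentiable_on I J f \<longleftrightarrow> differentiable_fst_on I J f \<and> differentiable_snd_on I J f"

text \<open>
  The mixed derivative \<open>\<partial>\<^sup>2f / \<partial>t \<partial>s = \<partial>/\<partial>t (\<partial>f/\<partial>s)\<close>: first in the second variable, then in the
  first one. Neither continuity nor integrability of the derivatives is required.
\<close>

definition mixed_partial :: "real set \<Rightarrow> real set \<Rightarrow> (real \<times> real \<Rightarrow> real) \<Rightarrow> real \<times> real \<Rightarrow> real" where
  "mixed_partial I J f = partial_fst I (partial_snd J f)"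

definition has_mixed_partial_on :: "real set \<Rightarrow> real set \<Rightarrow> (real \<times> real \<Rightarrow> real) \<Rightarrow> bool" where
  "has_mixed_partial_on I J f \<longleftrightarrow>
     differentiable_snd_on I J f \<and> differentiable_fst_on I J (partial_snd J f)"

definition coord_convex_on :: "real set \<Rightarrow> real set \<Rightarrow> (real \<times> real \<Rightarrow> real) \<Rightarrow> bool" where
  "coord_convex_on I J g \<longleftrightarrow>
     (\<forall>y\<in>J. convex_on I (\<lambda>u. g (u, y))) \<and> (\<forall>x\<in>I. convex_on J (\<lambda>v. g (x, v)))"

lemma partial_fst_eqI:
  assumes "a < b" "x \<in> {a..b}"
    and "((\<lambda>t. f (t, y)) has_real_derivative D) (at x within {a..b})"
  shows "partial_fst {a..b} f (x, y) = D"
  using vector_derivative_within_closed_interval[of a b x "\<lambda>t. f (t, y)" D] assms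
  by (simp add: partial_fst_def has_real_derivative_iff_has_vector_derivative)

lemma partial_snd_eqI:
  assumes "c < d" "y \<in> {c..d}"
    and "((\<lambda>s. f (x, s)) has_real_derivative D) (at y within {c..d})"
  shows "partial_snd {c..d} f (x, y) = D"
  using vector_derivative_within_closed_interval[of c d y "\<lambda>s. f (x, s)" D] assms
  by (simp add: partial_snd_def has_real_derivative_iff_has_vector_derivative)

end

theory Submission
  imports Defs
begin

text \<open>
  Coordinate convexity bounds the modulus of the mixed derivative by the bilinear interpolant of its
  corner values. By the mean value theorem, applied once in each variable, an inequality between
  mixed derivatives passes to the mixed increments over rectangles, so that the mixed derivative
  itself never has to be integrated. The left-hand side is the mean over the rectangle of the mixed
  increment between the midpoint and \<open>(x, y)\<close>, and integrating the bound leaves only the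
  contribution of the constant term of the interpolant, the other terms being odd about the midpoint.
\<close>

section \<open>Comparison of mixed increments\<close>

text \<open>For smooth \<open>f\<close> this is the integral of the mixed derivative over the
  rectangle with opposite corners \<open>(x, y)\<close> and \<open>(x', y')\<close>, taken with
  orientation: exchanging \<open>x\<close> with \<open>x'\<close>, or \<open>y\<close> with
  \<open>y'\<close>, flips the sign.\<close>

definition mixed_increment :: "(real \<times> real \<Rightarrow> real) \<Rightarrow> real \<Rightarrow> real \<Rightarrow> real \<Rightarrow> real \<Rightarrow> real" where
  "mixed_increment f x y x' y' = f (x', y') - f (x, y') - f (x', y) + f (x, y)"

lemma nondecreasing_within:
  fixes g g' :: "real \<Rightarrow> real"
  assumes deriv: "\<And>x. x \<in> {a..b} \<Longrightarrow> (g has_real_derivative g' x) (at x within {a..b})"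
    and nonneg: "\<And>x. x \<in> {a..b} \<Longrightarrow> 0 \<le> g' x"
    and "u \<in> {a..b}" "v \<in> {a..b}" "u \<le> v"
  shows "g u \<le> g v"
proof -
  have "\<exists>x\<in>{u..v}. g v - g u = g' x * (v - u)"
  proof (rule mvt_very_simple[OF \<open>u \<le> v\<close>])
    fix x assume "u \<le> x" "x \<le> v"
    then have "(g has_real_derivative g' x) (at x within {u..v})"
      by (intro has_field_derivative_subset[OF deriv]) (use assms(3,4) in auto)
    then show "(g has_derivative (*) (g' x)) (at x within {u..v})"
      by (simp add: has_field_derivative_def)
  qed
  then obtain x where "x \<in> {u..v}" "g v - g u = g' x * (v - u)" by blast
  moreover from this have "0 \<le> g' x" using nonneg assms(3,4) by auto
  ultimately have "0 \<le> g v - g u" using \<open>u \<le> v\<close> by simp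
  then show ?thesis by simp
qed

text \<open>Since \<open>Qts\<close> is nonnegative, \<open>Qs\<close> is nondecreasing in its first
  argument. Hence \<open>Q (x', s) - Q (x, s)\<close> has a nonnegative derivative in
  \<open>s\<close> and grows from \<open>y\<close> to \<open>y'\<close>.\<close>

lemma mixed_increment_nonneg:
  fixes Q Qs Qts :: "real \<times> real \<Rightarrow> real"
  assumes snd_deriv: "\<And>x y. x \<in> {a..b} \<Longrightarrow> y \<in> {c..d} \<Longrightarrow>
      ((\<lambda>s. Q (x, s)) has_real_derivative Qs (x, y)) (at y within {c..d})"
    and mixed_deriv: "\<And>x y. x \<in> {a..b} \<Longrightarrow> y \<in> {c..d} \<Longrightarrow>
      ((\<lambda>t. Qs (t, y)) has_real_derivative Qts (x, y)) (at x within {a..b})"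
    and nonneg: "\<And>x y. x \<in> {a..b} \<Longrightarrow> y \<in> {c..d} \<Longrightarrow> 0 \<le> Qts (x, y)"
    and x: "x \<in> {a..b}" "x' \<in> {a..b}" "x \<le> x'"
    and y: "y \<in> {c..d}" "y' \<in> {c..d}" "y \<le> y'"
  shows "0 \<le> mixed_increment Q x y x' y'"
proof -
  have "Q (x', y) - Q (x, y) \<le> Q (x', y') - Q (x, y')"
  proof (rule nondecreasing_within[where g = "\<lambda>s. Q (x', s) - Q (x, s)"
        and g' = "\<lambda>s. Qs (x', s) - Qs (x, s)", OF _ _ y])
    fix s assume s: "s \<in> {c..d}"
    show "((\<lambda>s. Q (x', s) - Q (x, s)) has_real_derivative Qs (x', s) - Qs (x, s))
        (at s within {c..d})"
      by (intro DERIV_diff snd_deriv x s)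
    have "Qs (x, s) \<le> Qs (x', s)"
      by (rule nondecreasing_within[where g = "\<lambda>t. Qs (t, s)", OF mixed_deriv nonneg x])
        (use s in auto)
    then show "0 \<le> Qs (x', s) - Qs (x, s)" by simp
  qed
  then show ?thesis by (simp add: mixed_increment_def)
qed

text \<open>Both \<open>P - f\<close> and \<open>P + f\<close> have nonnegative mixed derivative,
  which gives the bound for ordered corners. The factor \<open>sgn\<close> corrects the orientation
  of the increment of \<open>P\<close> when the corners are not ordered.\<close>

lemma abs_mixed_increment_le:
  fixes f fs fts P Ps Pts :: "real \<times> real \<Rightarrow> real"
  assumes f: "\<And>x y. x \<in> {a..b} \<Longrightarrow> y \<in> {c..d} \<Longrightarrow>
      ((\<lambda>s. f (x, s)) has_real_derivative fs (x, y)) (at y within {c..d})"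
    "\<And>x y. x \<in> {a..b} \<Longrightarrow> y \<in> {c..d} \<Longrightarrow>
      ((\<lambda>t. fs (t, y)) has_real_derivative fts (x, y)) (at x within {a..b})"
    and P: "\<And>x y. x \<in> {a..b} \<Longrightarrow> y \<in> {c..d} \<Longrightarrow>
      ((\<lambda>s. P (x, s)) has_real_derivative Ps (x, y)) (at y within {c..d})"
    "\<And>x y. x \<in> {a..b} \<Longrightarrow> y \<in> {c..d} \<Longrightarrow>
      ((\<lambda>t. Ps (t, y)) has_real_derivative Pts (x, y)) (at x within {a..b})"
    and le: "\<And>x y. x \<in> {a..b} \<Longrightarrow> y \<in> {c..d} \<Longrightarrow> \<bar>fts (x, y)\<bar> \<le> Pts (x, y)"
    and xy: "x \<in> {a..b}" "x' \<in> {a..b}" "y \<in> {c..d}" "y' \<in> {c..d}"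
  shows "\<bar>mixed_increment f x y x' y'\<bar>
    \<le> sgn ((x' - x) * (y' - y)) * mixed_increment P x y x' y'"
proof -
  have nonneg: "0 \<le> Pts (x, y) - fts (x, y)" "0 \<le> Pts (x, y) + fts (x, y)"
    if "x \<in> {a..b}" "y \<in> {c..d}" for x y
    using le[OF that] by (auto simp: abs_le_iff)
  have ordered: "\<bar>mixed_increment f x y x' y'\<bar> \<le> mixed_increment P x y x' y'"
    if "x \<in> {a..b}" "x' \<in> {a..b}" "x \<le> x'" "y \<in> {c..d}" "y' \<in> {c..d}" "y \<le> y'" for x x' y y'
  proof -
    have "0 \<le> mixed_increment (\<lambda>p. P p - f p) x y x' y'"
      by (rule mixed_increment_nonneg[where Qs = "\<lambda>p. Ps p - fs p" and Qts = "\<lambda>p. Pts p - fts p",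
            OF _ _ _ that])
        (intro DERIV_diff f P nonneg; assumption)+
    moreover have "0 \<le> mixed_increment (\<lambda>p. P p + f p) x y x' y'"
      by (rule mixed_increment_nonneg[where Qs = "\<lambda>p. Ps p + fs p" and Qts = "\<lambda>p. Pts p + fts p",
            OF _ _ _ that])
        (intro DERIV_add f P nonneg; assumption)+
    ultimately show ?thesis by (simp add: mixed_increment_def abs_le_iff)
  qed
  \<comment> \<open>In a degenerate rectangle both sides vanish. Each of the four orientations
    becomes the ordered one after exchanging coordinates, which leaves the absolute value on the
    left unchanged.\<close>
  consider "x = x' \<or> y = y'" | "x < x'" "y < y'" | "x < x'" "y' < y" | "x' < x" "y < y'"
    | "x' < x" "y' < y"
    by linarith
  then show ?thesis
  proof cases
    case 1
    then show ?thesis by (auto simp: mixed_increment_def)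
  next
    case 2
    then show ?thesis using ordered[of x x' y y'] xy by (simp add: sgn_mult)
  next
    case 3
    then show ?thesis using ordered[of x x' y' y] xy by (simp add: sgn_mult mixed_increment_def)
  next
    case 4
    then show ?thesis using ordered[of x' x y y'] xy by (simp add: sgn_mult mixed_increment_def)
  next
    case 5
    then show ?thesis using ordered[of x' x y' y] xy by (simp add: sgn_mult mixed_increment_def)
  qed
qed

section \<open>Interpolation bounds from convexity and the weighted integral about a
  midpoint\<close>

text \<open>The chord weights are written relative to the midpoint, so that the later product of two
  such bounds expands directly in centred coordinates.\<close>

lemma convex_on_le_chord:
  fixes g :: "real \<Rightarrow> real"
  assumes "a < b" "convex_on {a..b} g" "x \<in> {a..b}"
  shows "g x \<le> (1/2 - (x - (a + b) / 2) / (b - a)) * g a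
           + (1/2 + (x - (a + b) / 2) / (b - a)) * g b"
proof -
  define t where "t = (x - a) / (b - a)"
  have t: "0 \<le> t" "t \<le> 1" "1/2 - (x - (a + b) / 2) / (b - a) = 1 - t"
    "1/2 + (x - (a + b) / 2) / (b - a) = t"
    using assms by (auto simp: t_def field_simps)
  have "(1 - t) *\<^sub>R a + t *\<^sub>R b = a + t * (b - a)" by (simp add: algebra_simps)
  also have "\<dots> = x" using assms(1) by (simp add: t_def)
  finally have x: "(1 - t) *\<^sub>R a + t *\<^sub>R b = x" .
  show ?thesis
    using convex_onD[OF assms(2) t(1,2), of a b] assms(1) t(1,2) x unfolding t(3,4) by simp
qed

text \<open>The weight \<open>\<bar>y - m\<bar>\<close> is even about the midpoint, so the
  \<open>q\<close> term is odd and integrates to zero. What remains is \<open>p\<close> times the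
  area of two triangles, each of area \<open>(d - c)^2 / 8\<close>.\<close>

lemma integral_abs_times_affine:
  fixes p q :: real
  assumes "c \<le> d" and "m = (c + d) / 2"
  shows "((\<lambda>y. \<bar>y - m\<bar> * (p + q * (y - m))) has_integral p * (d - c)\<^sup>2 / 4) {c..d}"
proof -
  \<comment> \<open>One formula serves as antiderivative on both sides of the kink at
    \<open>m\<close>. It is continuous there, so the fundamental theorem applies with
    \<open>m\<close> as exceptional point.\<close>
  define G where "G y = \<bar>y - m\<bar> * (p * (y - m) / 2 + q * (y - m)\<^sup>2 / 3)" for y
  have "((\<lambda>y. \<bar>y - m\<bar> * (p + q * (y - m))) has_integral (G d - G c)) {c..d}"
  proof (rule fundamental_theorem_of_calculus_strong[where S = "{m}"])
    show "continuous_on {c..d} G" unfolding G_def by (intro continuous_intros) auto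
    fix y assume "y \<in> {c..d} - {m}"
    then have "y \<noteq> m" by simp
    have "(G has_real_derivative \<bar>y - m\<bar> * (p + q * (y - m))) (at y)"
    proof (cases "m < y")
      case True
      have "((\<lambda>y. (y - m) * (p * (y - m) / 2 + q * (y - m)\<^sup>2 / 3)) has_real_derivative
          \<bar>y - m\<bar> * (p + q * (y - m))) (at y)"
        by (rule derivative_eq_intros refl | simp)+
          (use True in \<open>simp add: field_simps power2_eq_square\<close>)
      then show ?thesis
        by (rule has_field_derivative_transform_within_open[where S = "{m<..}"])
          (use True in \<open>auto simp: G_def\<close>)
    next
      case False
      with \<open>y \<noteq> m\<close> have "y < m" by simp
      have "((\<lambda>y. (m - y) * (p * (y - m) / 2 + q * (y - m)\<^sup>2 / 3)) has_real_derivative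
          \<bar>y - m\<bar> * (p + q * (y - m))) (at y)"
        by (rule derivative_eq_intros refl | simp)+
          (use \<open>y < m\<close> in \<open>simp add: field_simps power2_eq_square\<close>)
      then show ?thesis
        by (rule has_field_derivative_transform_within_open[where S = "{..<m}"])
          (use \<open>y < m\<close> in \<open>auto simp: G_def\<close>)
    qed
    then show "(G has_vector_derivative \<bar>y - m\<bar> * (p + q * (y - m))) (at y)"
      by (simp add: has_real_derivative_iff_has_vector_derivative)
  qed (use assms in auto)
  moreover have "G d - G c = p * (d - c)\<^sup>2 / 4"
  proof -
    \<comment> \<open>With \<open>e\<close> the half-length, the cubic \<open>q\<close> terms of
      \<open>G d\<close> and \<open>G c\<close> coincide and cancel, while the quadratic
      \<open>p\<close> terms have opposite signs.\<close>
    define e where "e = (d - c) / 2"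
    have e: "d - m = e" "c - m = - e" "d - c = 2 * e" and "0 \<le> e"
      using assms by (auto simp: e_def field_simps)
    then show ?thesis unfolding G_def e by (simp add: power2_eq_square right_diff_distrib distrib_left)
  qed
  ultimately show ?thesis by simp
qed

text \<open>Convexity in the first variable bounds \<open>g (x, y)\<close> by values on the two
  edges \<open>x = a\<close> and \<open>x = b\<close>; convexity in the second bounds these by
  corner values. Only the constant term, the corner average, is made explicit, since the other
  coefficients vanish on integration.\<close>

lemma coord_convex_on_le_bilinear:
  assumes "a < b" "c < d" "coord_convex_on {a..b} {c..d} g"
  obtains \<beta> \<gamma> \<delta> where "\<And>x y. x \<in> {a..b} \<Longrightarrow> y \<in> {c..d} \<Longrightarrow>
    g (x, y) \<le> (g (a, c) + g (b, c) + g (a, d) + g (b, d)) / 4 + \<beta> * (x - (a + b) / 2)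
      + \<gamma> * (y - (c + d) / 2) + \<delta> * (x - (a + b) / 2) * (y - (c + d) / 2)"
proof (rule that)
  fix x y assume x: "x \<in> {a..b}" and y: "y \<in> {c..d}"
  define t where "t = (x - (a + b) / 2) / (b - a)"
  define s where "s = (y - (c + d) / 2) / (d - c)"
  have t: "0 \<le> 1/2 - t" "0 \<le> 1/2 + t" using x assms(1) by (auto simp: t_def field_simps)
  have conv: "convex_on {a..b} (\<lambda>u. g (u, y))" "convex_on {c..d} (\<lambda>v. g (a, v))"
    "convex_on {c..d} (\<lambda>v. g (b, v))"
    using assms y by (auto simp: coord_convex_on_def)
  have "g (x, y) \<le> (1/2 - t) * g (a, y) + (1/2 + t) * g (b, y)"
    using convex_on_le_chord[OF assms(1) conv(1) x] by (simp add: t_def)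
  also have "\<dots> \<le> (1/2 - t) * ((1/2 - s) * g (a, c) + (1/2 + s) * g (a, d))
      + (1/2 + t) * ((1/2 - s) * g (b, c) + (1/2 + s) * g (b, d))"
    using convex_on_le_chord[OF assms(2) conv(2) y] convex_on_le_chord[OF assms(2) conv(3) y] t
    by (intro add_mono mult_left_mono) (auto simp: s_def)
  also have "\<dots> = (g (a, c) + g (b, c) + g (a, d) + g (b, d)) / 4
      + (g (b, c) + g (b, d) - g (a, c) - g (a, d)) / 2 * t
      + (g (a, d) + g (b, d) - g (a, c) - g (b, c)) / 2 * s
      + (g (a, c) + g (b, d) - g (a, d) - g (b, c)) * t * s"
    by (simp add: field_simps)
  finally show "g (x, y) \<le> (g (a, c) + g (b, c) + g (a, d) + g (b, d)) / 4
      + (g (b, c) + g (b, d) - g (a, c) - g (a, d)) / (2 * (b - a)) * (x - (a + b) / 2)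
      + (g (a, d) + g (b, d) - g (a, c) - g (b, c)) / (2 * (d - c)) * (y - (c + d) / 2)
      + (g (a, c) + g (b, d) - g (a, d) - g (b, c)) / ((b - a) * (d - c))
        * (x - (a + b) / 2) * (y - (c + d) / 2)"
    by (simp add: t_def s_def)
qed

section \<open>Regularity of the partial derivatives and of the inner integral\<close>

lemma has_mixed_partial_on_derivatives:
  assumes "has_mixed_partial_on I J f" "x \<in> I" "y \<in> J"
  shows "((\<lambda>s. f (x, s)) has_real_derivative partial_snd J f (x, y)) (at y within J)"
    and "((\<lambda>t. partial_snd J f (t, y)) has_real_derivative mixed_partial I J f (x, y)) (at x within I)"
proof -
  have "(\<lambda>s. f (x, s)) differentiable (at y within J)"
    and "(\<lambda>t. partial_snd J f (t, y)) differentiable (at x within I)"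
    using assms by (auto simp: has_mixed_partial_on_def differentiable_snd_on_def
        differentiable_fst_on_def differentiable_on_def)
  then show "((\<lambda>s. f (x, s)) has_real_derivative partial_snd J f (x, y)) (at y within J)"
    and "((\<lambda>t. partial_snd J f (t, y)) has_real_derivative mixed_partial I J f (x, y)) (at x within I)"
    unfolding has_real_derivative_iff_has_vector_derivative vector_derivative_works
    by (simp_all only: mixed_partial_def partial_fst_def partial_snd_def fst_conv snd_conv)
qed

text \<open>
  Separate continuity does not suffice here. The proof subtracts \<open>f (x, c)\<close> from the integrand
  because the boundedness of the mixed derivative makes the differences \<open>f (x, y) - f (x, c)\<close>
  Lipschitz in \<open>x\<close>, uniformly in \<open>y\<close>.
\<close>

lemma continuous_on_integral_snd:
  fixes f fs fts :: "real \<times> real \<Rightarrow> real"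
  assumes "c \<le> d"
    and f: "\<And>x y. x \<in> {a..b} \<Longrightarrow> y \<in> {c..d} \<Longrightarrow>
      ((\<lambda>s. f (x, s)) has_real_derivative fs (x, y)) (at y within {c..d})"
    "\<And>x y. x \<in> {a..b} \<Longrightarrow> y \<in> {c..d} \<Longrightarrow>
      ((\<lambda>t. fs (t, y)) has_real_derivative fts (x, y)) (at x within {a..b})"
    and bound: "\<And>x y. x \<in> {a..b} \<Longrightarrow> y \<in> {c..d} \<Longrightarrow> \<bar>fts (x, y)\<bar> \<le> M"
    and cont_c: "continuous_on {a..b} (\<lambda>x. f (x, c))"
  shows "continuous_on {a..b} (\<lambda>x. integral {c..d} (\<lambda>y. f (x, y)))"
proof -
  define \<phi> where "\<phi> x = integral {c..d} (\<lambda>y. f (x, y) - f (x, c))" for x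
  have cont_y: "continuous_on {c..d} (\<lambda>y. f (x, y))" if "x \<in> {a..b}" for x
    using DERIV_continuous_on[OF f(1)[OF that]] .
  have incr: "\<bar>mixed_increment f x c x' y\<bar> \<le> M * (d - c) * \<bar>x' - x\<bar>"
    if "x \<in> {a..b}" "x' \<in> {a..b}" "y \<in> {c..d}" for x x' y
  proof -
    have M: "0 \<le> M" using bound[of x y] that by auto
    \<comment> \<open>The comparison function \<open>M * x * y\<close> has constant mixed derivative
      \<open>M\<close>; its increment is \<open>M\<close> times the signed area of the
      rectangle.\<close>
    have "\<bar>mixed_increment f x c x' y\<bar>
        \<le> sgn ((x' - x) * (y - c)) * mixed_increment (\<lambda>p. M * fst p * snd p) x c x' y"
      by (rule abs_mixed_increment_le[OF f, where Ps = "\<lambda>p. M * fst p" and Pts = "\<lambda>p. M"])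
        (use that bound in \<open>auto intro!: derivative_eq_intros\<close>)
    also have "\<dots> = M * \<bar>(x' - x) * (y - c)\<bar>"
      by (simp add: mixed_increment_def abs_sgn algebra_simps)
    also have "\<dots> \<le> M * ((d - c) * \<bar>x' - x\<bar>)"
      using M that by (intro mult_left_mono)
        (auto simp: abs_mult mult.commute[of _ "\<bar>x' - x\<bar>"] intro: mult_left_mono)
    finally show ?thesis by simp
  qed
  \<comment> \<open>The condition \<open>a \<le> b\<close> supplies the point \<open>(a, c)\<close>,
    from which \<open>0 \<le> M\<close> is read off. Otherwise the interval is empty and continuity
    is trivial.\<close>
  have "(M * (d - c) * (d - c))-lipschitz_on {a..b} \<phi>" if "a \<le> b"
  proof (rule lipschitz_onI)
    have "0 \<le> M" using bound[of a c] that assms(1) by auto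
    then show "0 \<le> M * (d - c) * (d - c)" using assms(1) by simp
    fix x x' assume x: "x \<in> {a..b}" and x': "x' \<in> {a..b}"
    have "\<phi> x - \<phi> x' = integral {c..d} (\<lambda>y. mixed_increment f x' c x y)"
      unfolding \<phi>_def mixed_increment_def
      by (subst integral_diff[symmetric])
        (auto intro!: integrable_continuous_real continuous_on_diff continuous_on_const cont_y x x'
          simp: algebra_simps)
    also have "norm \<dots> \<le> M * (d - c) * \<bar>x - x'\<bar> * (d - c)"
      by (rule integral_bound)
        (use assms(1) x x' incr in \<open>auto simp: mixed_increment_def
          intro!: continuous_on_add continuous_on_diff continuous_on_const cont_y\<close>)
    finally show "dist (\<phi> x) (\<phi> x') \<le> M * (d - c) * (d - c) * dist x x'"
      by (simp add: dist_real_def ac_simps)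
  qed
  then have "continuous_on {a..b} \<phi>"
    by (cases "a \<le> b") (auto intro: lipschitz_on_continuous_on)
  then have "continuous_on {a..b} (\<lambda>x. \<phi> x + (d - c) * f (x, c))"
    by (intro continuous_intros cont_c)
  moreover have "\<phi> x + (d - c) * f (x, c) = integral {c..d} (\<lambda>y. f (x, y))" if "x \<in> {a..b}" for x
    unfolding \<phi>_def using assms(1) cont_y[OF that]
    by (subst integral_diff) (auto intro: integrable_continuous_real)
  ultimately show ?thesis by (rule continuous_on_eq)
qed

section \<open>Bounding the centred mixed increment and averaging it\<close>

lemma abs_mixed_increment_le_bilinear:
  fixes f fs fts :: "real \<times> real \<Rightarrow> real"
  assumes f: "\<And>x y. x \<in> {a..b} \<Longrightarrow> y \<in> {c..d} \<Longrightarrow>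
      ((\<lambda>s. f (x, s)) has_real_derivative fs (x, y)) (at y within {c..d})"
    "\<And>x y. x \<in> {a..b} \<Longrightarrow> y \<in> {c..d} \<Longrightarrow>
      ((\<lambda>t. fs (t, y)) has_real_derivative fts (x, y)) (at x within {a..b})"
    and bound: "\<And>x y. x \<in> {a..b} \<Longrightarrow> y \<in> {c..d} \<Longrightarrow>
      \<bar>fts (x, y)\<bar> \<le> \<alpha> + \<beta> * (x - m) + \<gamma> * (y - n) + \<delta> * (x - m) * (y - n)"
    and "m \<in> {a..b}" "n \<in> {c..d}" "x \<in> {a..b}" "y \<in> {c..d}"
  shows "\<bar>mixed_increment f m n x y\<bar> \<le> \<bar>x - m\<bar> * (\<bar>y - n\<bar>
    * ((\<alpha> + \<beta> / 2 * (x - m)) + (\<gamma> / 2 + \<delta> / 4 * (x - m)) * (y - n)))"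
proof -
  \<comment> \<open>\<open>P\<close> is the antiderivative in both variables of the bilinear bound
    \<open>Pts\<close> that vanishes on the lines \<open>x = m\<close> and \<open>y = n\<close>. Its
    increment from \<open>(m, n)\<close> is therefore just its value at
    \<open>(x, y)\<close>.\<close>
  define P where "P p = (fst p - m) * (snd p - n)
    * (\<alpha> + \<beta> / 2 * (fst p - m) + (\<gamma> / 2 + \<delta> / 4 * (fst p - m)) * (snd p - n))"
    for p :: "real \<times> real"
  define Ps where "Ps p = (fst p - m) * (\<alpha> + \<beta> / 2 * (fst p - m)
    + (\<gamma> + \<delta> / 2 * (fst p - m)) * (snd p - n))" for p :: "real \<times> real"
  define Pts where "Pts p = \<alpha> + \<beta> * (fst p - m) + \<gamma> * (snd p - n)
    + \<delta> * (fst p - m) * (snd p - n)" for p :: "real \<times> real"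
  have "\<bar>mixed_increment f m n x y\<bar> \<le> sgn ((x - m) * (y - n)) * mixed_increment P m n x y"
  proof (rule abs_mixed_increment_le[OF f])
    show "((\<lambda>s. P (x, s)) has_real_derivative Ps (x, y)) (at y within {c..d})" for x y
      unfolding P_def Ps_def
      by (rule derivative_eq_intros refl | simp)+ (simp add: field_simps)
    show "((\<lambda>t. Ps (t, y)) has_real_derivative Pts (x, y)) (at x within {a..b})" for x y
      unfolding Ps_def Pts_def
      by (rule derivative_eq_intros refl | simp)+ (simp add: field_simps)
  qed (use assms(4-) bound in \<open>auto simp: Pts_def\<close>)
  also have "\<dots> = \<bar>x - m\<bar> * (\<bar>y - n\<bar>
    * ((\<alpha> + \<beta> / 2 * (x - m)) + (\<gamma> / 2 + \<delta> / 4 * (x - m)) * (y - n)))"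
    by (simp add: mixed_increment_def P_def sgn_mult abs_sgn[of "x - m"] abs_sgn[of "y - n"])
  finally show ?thesis .
qed

theorem theorem7:
  fixes a b c d :: real and f :: "real \<times> real \<Rightarrow> real"
  assumes "a < b" and "c < d"
    and "partially_differentiable_on {a..b} {c..d} f"
    and "has_mixed_partial_on {a..b} {c..d} f"
    and "coord_convex_on {a..b} {c..d} (\<lambda>p. \<bar>mixed_partial {a..b} {c..d} f p\<bar>)"
  shows "\<bar>f ((a + b) / 2, (c + d) / 2)
          - 1 / (d - c) * integral {c..d} (\<lambda>y. f ((a + b) / 2, y))
          - 1 / (b - a) * integral {a..b} (\<lambda>x. f (x, (c + d) / 2))
          + 1 / ((b - a) * (d - c)) * integral {a..b} (\<lambda>x. integral {c..d} (\<lambda>y. f (x, y)))\<bar>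
       \<le> (b - a) * (d - c) / 64 *
          (\<bar>mixed_partial {a..b} {c..d} f (a, c)\<bar> + \<bar>mixed_partial {a..b} {c..d} f (b, c)\<bar>
         + \<bar>mixed_partial {a..b} {c..d} f (a, d)\<bar> + \<bar>mixed_partial {a..b} {c..d} f (b, d)\<bar>)"
proof -
  let ?h = "mixed_partial {a..b} {c..d} f"
  define m where "m = (a + b) / 2"
  define n where "n = (c + d) / 2"
  define \<alpha> where "\<alpha> = (\<bar>?h (a, c)\<bar> + \<bar>?h (b, c)\<bar> + \<bar>?h (a, d)\<bar> + \<bar>?h (b, d)\<bar>) / 4"
  have m: "m \<in> {a..b}" and n: "n \<in> {c..d}" using assms(1,2) by (auto simp: m_def n_def)
  note deriv = has_mixed_partial_on_derivatives[OF assms(4)]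
  obtain \<beta> \<gamma> \<delta> where bilinear: "\<And>x y. x \<in> {a..b} \<Longrightarrow> y \<in> {c..d} \<Longrightarrow>
      \<bar>?h (x, y)\<bar> \<le> \<alpha> + \<beta> * (x - m) + \<gamma> * (y - n) + \<delta> * (x - m) * (y - n)"
    using coord_convex_on_le_bilinear[OF assms(1,2,5)] unfolding \<alpha>_def m_def n_def by metis
  have incr: "\<bar>mixed_increment f m n x y\<bar> \<le> \<bar>x - m\<bar> * (\<bar>y - n\<bar>
      * ((\<alpha> + \<beta> / 2 * (x - m)) + (\<gamma> / 2 + \<delta> / 4 * (x - m)) * (y - n)))"
    if "x \<in> {a..b}" "y \<in> {c..d}" for x y
    by (rule abs_mixed_increment_le_bilinear[OF deriv bilinear m n that])

  \<comment> \<open>A crude constant bound on the mixed derivative is what the continuity of the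
    inner integral \<open>I\<close> rests on.\<close>
  have bounded: "\<bar>?h (x, y)\<bar>
      \<le> \<bar>\<alpha>\<bar> + \<bar>\<beta>\<bar> * (b - a) + \<bar>\<gamma>\<bar> * (d - c) + \<bar>\<delta>\<bar> * (b - a) * (d - c)"
    if x: "x \<in> {a..b}" and y: "y \<in> {c..d}" for x y
  proof -
    have u: "\<bar>x - m\<bar> \<le> b - a" and v: "\<bar>y - n\<bar> \<le> d - c" using x y m n by auto
    have uv: "\<bar>(x - m) * (y - n)\<bar> \<le> (b - a) * (d - c)"
      using mult_mono[OF u v] assms(1) by (simp add: abs_mult)
    have le: "z * w \<le> \<bar>z\<bar> * e" if "\<bar>w\<bar> \<le> e" for z w e :: real
      using abs_ge_self[of "z * w"] mult_left_mono[OF that abs_ge_zero[of z]]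
      by (simp add: abs_mult)
    show ?thesis
      using bilinear[OF x y] unfolding mult.assoc
      by (rule order_trans) (intro add_mono abs_ge_self le u v uv)
  qed
  have cont_snd: "continuous_on {c..d} (\<lambda>y. f (x, y))" if "x \<in> {a..b}" for x
    using DERIV_continuous_on[OF deriv(1)[OF that]] .
  have cont_fst: "continuous_on {a..b} (\<lambda>x. f (x, y))" if "y \<in> {c..d}" for y
    using assms(3) that
    by (auto simp: partially_differentiable_on_def differentiable_fst_on_def
        intro: differentiable_imp_continuous_on)
  define I where "I x = integral {c..d} (\<lambda>y. f (x, y))" for x
  have cont_I: "continuous_on {a..b} I"
    unfolding I_def using assms(2) cont_fst
    by (intro continuous_on_integral_snd[OF _ deriv bounded]) auto

  define J where "J x = integral {c..d} (\<lambda>y. mixed_increment f m n x y)" for x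
  have J_eq: "J x = I x - I m - (d - c) * f (x, n) + (d - c) * f (m, n)" if "x \<in> {a..b}" for x
  proof -
    have "((\<lambda>y. f (x, y) - f (m, y) - f (x, n) + f (m, n)) has_integral
        I x - I m - (d - c) * f (x, n) + (d - c) * f (m, n)) {c..d}"
      unfolding I_def using assms(2) cont_snd[OF that] cont_snd[OF m]
      by (intro has_integral_add has_integral_diff integrable_integral integrable_continuous_real)
        (use has_integral_const_real[of "f (x, n)" c d] has_integral_const_real[of "f (m, n)" c d]
          in auto)
    then show ?thesis by (simp add: J_def mixed_increment_def integral_unique)
  qed
  \<comment> \<open>Integrating in \<open>y\<close> removes the coefficients \<open>\<gamma>\<close>
    and \<open>\<delta>\<close>, whose terms are odd about \<open>n\<close>. The result is again a
    centred absolute value times an affine function, now in \<open>x\<close>.\<close>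
  have J_le: "\<bar>J x\<bar> \<le> (d - c)\<^sup>2 / 4 * (\<bar>x - m\<bar> * (\<alpha> + \<beta> / 2 * (x - m)))"
    if x: "x \<in> {a..b}" for x
  proof -
    have B: "((\<lambda>y. \<bar>x - m\<bar> * (\<bar>y - n\<bar>
        * ((\<alpha> + \<beta> / 2 * (x - m)) + (\<gamma> / 2 + \<delta> / 4 * (x - m)) * (y - n))))
      has_integral \<bar>x - m\<bar> * ((\<alpha> + \<beta> / 2 * (x - m)) * (d - c)\<^sup>2 / 4)) {c..d}"
      using assms(2) by (intro has_integral_mult_right integral_abs_times_affine) (auto simp: n_def)
    have "norm (J x) \<le> integral {c..d} (\<lambda>y. \<bar>x - m\<bar> * (\<bar>y - n\<bar>
        * ((\<alpha> + \<beta> / 2 * (x - m)) + (\<gamma> / 2 + \<delta> / 4 * (x - m)) * (y - n))))"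
      unfolding J_def
    proof (rule integral_norm_bound_integral)
      show "(\<lambda>y. mixed_increment f m n x y) integrable_on {c..d}"
        unfolding mixed_increment_def
        by (intro integrable_continuous_real continuous_intros cont_snd m x)
    qed (use B incr[OF x] in auto)
    also note integral_unique[OF B]
    finally show ?thesis by (simp add: ac_simps)
  qed
  have cont_J: "continuous_on {a..b} J"
    by (rule continuous_on_eq[OF _ J_eq[symmetric]]) (intro continuous_intros cont_I cont_fst n)
  \<comment> \<open>The second integration removes \<open>\<beta>\<close> by the same symmetry,
    leaving only \<open>\<alpha>\<close>.\<close>
  have B: "((\<lambda>x. (d - c)\<^sup>2 / 4 * (\<bar>x - m\<bar> * (\<alpha> + \<beta> / 2 * (x - m)))) has_integral
      (d - c)\<^sup>2 / 4 * (\<alpha> * (b - a)\<^sup>2 / 4)) {a..b}"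
    using assms(1) by (intro has_integral_mult_right integral_abs_times_affine) (auto simp: m_def)
  have "norm (integral {a..b} J)
      \<le> integral {a..b} (\<lambda>x. (d - c)\<^sup>2 / 4 * (\<bar>x - m\<bar> * (\<alpha> + \<beta> / 2 * (x - m))))"
    using J_le by (intro integral_norm_bound_integral integrable_continuous_real[OF cont_J]
        has_integral_integrable[OF B]) auto
  then have le: "\<bar>integral {a..b} J\<bar> \<le> (d - c)\<^sup>2 / 4 * (\<alpha> * (b - a)\<^sup>2 / 4)"
    unfolding integral_unique[OF B] real_norm_def .

  \<comment> \<open>Integrating the expression for \<open>J\<close> term by term shows that the
    quantity to be bounded is the integral of \<open>J\<close> divided by the area of the
    rectangle.\<close>
  have "((\<lambda>x. I x - I m - (d - c) * f (x, n) + (d - c) * f (m, n)) has_integral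
      integral {a..b} I - (b - a) * I m - (d - c) * integral {a..b} (\<lambda>x. f (x, n))
        + (b - a) * ((d - c) * f (m, n))) {a..b}"
    using assms(1) cont_I cont_fst[OF n]
    by (intro has_integral_add has_integral_diff has_integral_mult_right integrable_integral
        integrable_continuous_real)
      (use has_integral_const_real[of "I m" a b]
          has_integral_const_real[of "(d - c) * f (m, n)" a b] in auto)
  then have "(J has_integral integral {a..b} I - (b - a) * I m
      - (d - c) * integral {a..b} (\<lambda>x. f (x, n)) + (b - a) * ((d - c) * f (m, n))) {a..b}"
    by (rule has_integral_eq[rotated]) (simp add: J_eq)
  then have "f (m, n) - 1 / (d - c) * I m - 1 / (b - a) * integral {a..b} (\<lambda>x. f (x, n))
      + 1 / ((b - a) * (d - c)) * integral {a..b} I = integral {a..b} J / ((b - a) * (d - c))"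
    using assms(1,2) by (simp add: integral_unique add_divide_distrib diff_divide_distrib)
  also have "\<bar>\<dots>\<bar> = \<bar>integral {a..b} J\<bar> / ((b - a) * (d - c))"
    using assms(1,2) by simp
  also have "\<dots> \<le> (d - c)\<^sup>2 / 4 * (\<alpha> * (b - a)\<^sup>2 / 4) / ((b - a) * (d - c))"
    using le assms(1,2) by (intro divide_right_mono) auto
  \<comment> \<open>The constant 64 is \<open>4 * 4 * 4\<close>: one factor from each of the two
    integrations and one from the corner average \<open>\<alpha>\<close>.\<close>
  also have "\<dots> = (b - a) * (d - c) / 64
      * (\<bar>?h (a, c)\<bar> + \<bar>?h (b, c)\<bar> + \<bar>?h (a, d)\<bar> + \<bar>?h (b, d)\<bar>)"
  proof -
    have cancel: "s\<^sup>2 / 4 * (S / 4 * r\<^sup>2 / 4) / (r * s) = r * s / 64 * S"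
      if "r \<noteq> 0" "s \<noteq> 0" for r s S :: real
      using that by (simp add: field_simps power2_eq_square)
    show ?thesis unfolding \<alpha>_def by (rule cancel) (use assms(1,2) in auto)
  qed
  finally show ?thesis unfolding m_def n_def I_def .
qed

end
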